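(* Let $b$ and $p_i,q_i,\alpha_i,\beta_i$ ($i=1,2,\dots$) be constants with $q_i=-p_i-b$ for all $i$, and let $c_2(l_2)$ be an arbitrary function of $l_2$. Put $$\phi_{i,l_2}^{s}=\alpha_i p_i^s\prod_{j}^{l_2-1}(1-c_2(j)p_i)+\beta_i q_i^s\prod_{j}^{l_2-1}(1-c_2(j)q_i),$$ and let $\kappa=\kappa_{l_1,l_2}^s$ be the $l_1\times l_1$ determinant $\kappa=\det\left(\phi_{i,l_2}^{s+j-1}\right)_{i,j=1,\dots,l_1}$. Then $\kappa$ satisfies the bilinear equations $$c_1(l_1)\,\kappa^{s+2}\,\kappa_{l_1+1}-\kappa\,\kappa_{l_1+1}^{s+2}=b\,\kappa^{s+1}\,\kappa_{l_1+1}^{s+1},$$ $$(1+c_2(l_2)b)\,\kappa^{s+2}\,\kappa_{l_2+1}-\kappa\,\kappa_{l_2+1}^{s+2}=c_2(l_2)b\,\kappa^{s+1}\,\kappa_{l_2+1}^{s+1},$$ where $$c_1(l_1)=p_{l_1+1}^2\left(1+\frac{b}{p_{l_1+1}}\right).$$ Moreover, for fixed $s$, $$z_{l_1,l_2}=\prod_{j_1}^{l_1-1}c_1(j_1)^{-1}\prod_{j_2}^{l_2-1}(1+c_2(j_2)b)^{-1}\ \frac{\kappa^{s+2}}{\kappa}$$ satisfies the discrete Schwarzian KdV equation $$\frac{(z-z_{l_1+1})(z_{l_1+1,l_2+1}-z_{l_2+1})}{(z_{l_1+1}-z_{l_1+1,l_2+1})(z_{l_2+1}-z)}=\frac{\lambda(l_1)}{\mu(l_2)}$$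 with $\lambda(l_1)=c_1(l_1)^{-1}$ and $\mu(l_2)=c_2(l_2)^2/(1+c_2(l_2)b)$.
   Context: Here $l_1$ is a nonnegative integer (the size of the determinant; a $0\times0$ determinant equals $1$), $l_2,s$ are integers, and all functions are complex-valued. Only shifted independent variables are displayed: $\kappa=\kappa_{l_1,l_2}^s$, $\kappa_{l_k+1}^{s+2}$ is $\kappa$ with $l_k$ raised by one and $s$ raised by two, $z=z_{l_1,l_2}$, $z_{l_1+1}=z_{l_1+1,l_2}$, etc. The symbol $\prod_{j}^{l-1}g(j)$ denotes an indefinite product with an arbitrary fixed lower limit, i.e. a function $G(l)$ with $G(l+1)=g(l)G(l)$. Quantities occurring in denominators or raised to negative powers are understood to be nonzero. *)

theory Defs
  imports Complex_Main "Jordan_Normal_Form.Determinant"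
begin

text \<open>
  \<open>indefinite_product g G\<close> says that \<open>G l\<close> is an indefinite product \<open>\<Prod>\<^sub>j\<close> of \<open>g j\<close> with upper
  limit \<open>l - 1\<close>. The lower limit being arbitrary, this is a relation: \<open>G\<close> is not determined
  by \<open>g\<close>.
\<close>

definition indefinite_product ::
    "('a::semiring_1 \<Rightarrow> complex) \<Rightarrow> ('a \<Rightarrow> complex) \<Rightarrow> bool" where
  "indefinite_product g G \<longleftrightarrow> (\<forall>l. G (l + 1) = g l * G l)"

text \<open>
  \<open>P i\<close> and \<open>Q i\<close> are the indefinite products of \<open>1 - c2 j * p i\<close> and \<open>1 - c2 j * q i\<close>;
  the index \<open>i\<close> starts at 1.
\<close>

definition phi ::
    "(nat \<Rightarrow> complex) \<Rightarrow> (nat \<Rightarrow> complex) \<Rightarrow> (nat \<Rightarrow> complex) \<Rightarrow> (nat \<Rightarrow> complex) \<Rightarrow>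
     (nat \<Rightarrow> int \<Rightarrow> complex) \<Rightarrow> (nat \<Rightarrow> int \<Rightarrow> complex) \<Rightarrow> nat \<Rightarrow> int \<Rightarrow> int \<Rightarrow> complex" where
  "phi \<alpha> \<beta> p q P Q i l2 s = \<alpha> i * p i powi s * P i l2 + \<beta> i * q i powi s * Q i l2"

text \<open>
  Matrix indices of \<^const>\<open>mat\<close> start at 0, so the entry at \<open>(i, j)\<close> is the usual entry
  at \<open>(i + 1, j + 1)\<close>, and the superscript \<open>s + j - 1\<close> becomes \<open>s + j\<close>.
\<close>

definition kappa :: "(nat \<Rightarrow> int \<Rightarrow> int \<Rightarrow> complex) \<Rightarrow> nat \<Rightarrow> int \<Rightarrow> int \<Rightarrow> complex" where
  "kappa \<phi> l1 l2 s = det (mat l1 l1 (\<lambda>(i, j). \<phi> (i + 1) l2 (s + int j)))"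

end

theory Submission
  imports Defs
begin

text \<open>
  Since \<open>p\<^sub>i\<close> and \<open>q\<^sub>i\<close> are the roots of \<open>x\<^sup>2 + b x = c\<^sub>i\<close> with \<open>c\<^sub>i = - p\<^sub>i q\<^sub>i\<close>, the columns \<open>f\<^sub>j\<close> of
  \<open>\<kappa>\<close> satisfy \<open>D f\<^sub>j = f\<^sub>j\<^sub>+\<^sub>2 + b f\<^sub>j\<^sub>+\<^sub>1\<close> with the diagonal matrix \<open>D = diag(c\<^sub>i)\<close>. For every
  sequence \<open>h\<^sub>j\<close> of such columns of height \<open>N\<close>, the three-term Pluecker relation for the columns
  \<open>D h\<^sub>0\<close>, \<open>D h\<^sub>N\<^sub>-\<^sub>1\<close>, \<open>h\<^sub>2\<close>, \<open>d\<close> over the common columns \<open>D h\<^sub>1, \<dots>, D h\<^sub>N\<^sub>-\<^sub>2\<close> becomes, after column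
  operations, a bilinear identity that is linear in \<open>d\<close>. Taking \<open>h = f\<close> and for \<open>d\<close> the last unit
  vector gives the equation in \<open>l\<^sub>1\<close>; taking \<open>h\<^sub>j = f\<^sub>j - c\<^sub>2(l\<^sub>2) f\<^sub>j\<^sub>+\<^sub>1\<close>, which is the column sequence at
  \<open>l\<^sub>2 + 1\<close>, and \<open>d = D f\<^sub>N\<^sub>-\<^sub>1\<close> gives the equation in \<open>l\<^sub>2\<close>. By the bilinear equations all four
  differences of \<open>z\<close> in the cross ratio factorise, and the factors \<open>\<kappa>\<close> cancel.
\<close>

section \<open>Determinants as alternating multilinear functions of their columns\<close>

text \<open>The column index comes first, so that \<open>v(k := u)\<close> replaces a column;
  \<open>v\<close> may be an infinite sequence, of which the leading \<open>n\<close> by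
  \<open>n\<close> block counts.\<close>

definition coldet :: "nat \<Rightarrow> (nat \<Rightarrow> nat \<Rightarrow> 'a::comm_ring_1) \<Rightarrow> 'a" where
  "coldet n v = det (mat n n (\<lambda>(i, j). v j i))"

lemma coldet_cong:
  assumes "\<And>i j. i < n \<Longrightarrow> j < n \<Longrightarrow> v j i = w j i"
  shows "coldet n v = coldet n w"
  unfolding coldet_def by (rule arg_cong[where f = det]) (auto simp: assms)

lemma coldet_1 [simp]: "coldet (Suc 0) v = v 0 0"
  unfolding coldet_def by (subst det_single) auto

lemma coldet_mult:
  "coldet n (\<lambda>j i. \<Sum>k<n. v k i * m k j) = coldet n v * det (mat n n (\<lambda>(k, j). m k j))"
proof -
  have "mat n n (\<lambda>(i, j). \<Sum>k<n. v k i * m k j)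
      = mat n n (\<lambda>(i, k). v k i) * mat n n (\<lambda>(k, j). m k j)"
    by (auto simp: scalar_prod_def lessThan_atLeast0 intro!: eq_matI sum.cong)
  then show ?thesis
    unfolding coldet_def by (simp add: det_mult[of _ n])
qed

text \<open>The cofactors along column \<open>k\<close> do not see that column, so those of
  \<open>v\<close> serve for every \<open>u\<close>.\<close>

lemma coldet_expand_column:
  assumes "k < n"
  shows "coldet n (v(k := u)) = (\<Sum>i<n. u i * cofactor (mat n n (\<lambda>(i, j). v j i)) i k)"
proof -
  let ?A = "mat n n (\<lambda>(i, j). v j i)" and ?B = "mat n n (\<lambda>(i, j). (v(k := u)) j i)"
  have "mat_delete ?B i k = mat_delete ?A i k" for i
    unfolding mat_delete_def by (rule eq_matI) auto
  then show ?thesis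
    unfolding coldet_def using assms
    by (subst laplace_expansion_column[of _ n k]) (auto simp: cofactor_def)
qed

lemma coldet_column_lincomb:
  assumes "k < n"
  shows "coldet n (v(k := \<lambda>i. s * x i + t * y i)) = s * coldet n (v(k := x)) + t * coldet n (v(k := y))"
  unfolding coldet_expand_column[OF assms]
  by (simp add: sum_distrib_left sum.distrib algebra_simps)

lemma coldet_column_sum:
  assumes "k < n"
  shows "coldet n (v(k := \<lambda>i. \<Sum>m\<in>M. s m * x m i)) = (\<Sum>m\<in>M. s m * coldet n (v(k := x m)))"
  unfolding coldet_expand_column[OF assms]
  by (simp add: sum_distrib_left sum_distrib_right mult.assoc) (rule sum.swap)

lemma coldet_identical_columns:
  assumes "j \<noteq> k" "j < n" "k < n" "v j = v k"
  shows "coldet n v = 0"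
  unfolding coldet_def
  by (rule det_identical_columns[of _ n j k]) (use assms in auto)

lemma coldet_swap:
  assumes "j \<noteq> k" "j < n" "k < n"
  shows "coldet n (v(j := x, k := y)) = - coldet n (v(j := y, k := x))"
proof -
  let ?W = "\<lambda>a b. coldet n (v(j := a, k := b))"
  let ?z = "\<lambda>i. 1 * x i + 1 * y i"
  have L: "?W ?z b = ?W x b + ?W y b" for b
    using coldet_column_lincomb[OF assms(2), of "v(k := b)" 1 x 1 y] assms(1)
    by (simp add: fun_upd_twist)
  have R: "?W a ?z = ?W a x + ?W a y" for a
    using coldet_column_lincomb[OF assms(3), of "v(j := a)" 1 x 1 y] by simp
  have Z: "?W a a = 0" for a
    by (rule coldet_identical_columns[of j k]) (use assms in auto)
  have "0 = ?W ?z ?z" by (rule Z[symmetric])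
  also have "\<dots> = ?W x y + ?W y x" by (simp add: L R Z del: mult_1)
  finally show ?thesis by (simp add: eq_neg_iff_add_eq_0)
qed

text \<open>Cramer's rule without division: the matrix times its adjugate is the determinant times
  the identity, applied to \<open>u\<close>. Singular matrices are allowed.\<close>

lemma coldet_column_cramer:
  assumes "i < n"
  shows "coldet n v * u i = (\<Sum>k<n. v k i * coldet n (v(k := u)))"
proof -
  let ?A = "mat n n (\<lambda>(i, j). v j i)"
  have A: "?A \<in> carrier_mat n n" by simp
  have inv: "(\<Sum>k<n. v k i * cofactor ?A m k) = (if i = m then coldet n v else 0)" if "m < n" for m
  proof -
    have "(?A * adj_mat ?A) $$ (i, m) = (\<Sum>k<n. v k i * cofactor ?A m k)"
      using assms that by (simp add: adj_mat_def scalar_prod_def lessThan_atLeast0)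
    also have "(?A * adj_mat ?A) $$ (i, m) = (if i = m then coldet n v else 0)"
      unfolding adj_mat(2)[OF A] using assms that by (simp add: coldet_def)
    finally show ?thesis ..
  qed
  have "(\<Sum>k<n. v k i * coldet n (v(k := u))) = (\<Sum>k<n. \<Sum>m<n. u m * (v k i * cofactor ?A m k))"
    by (intro sum.cong refl) (simp add: coldet_expand_column sum_distrib_left algebra_simps)
  also have "\<dots> = (\<Sum>m<n. u m * (\<Sum>k<n. v k i * cofactor ?A m k))"
    by (subst sum.swap) (simp add: sum_distrib_left)
  also have "\<dots> = (\<Sum>m<n. if i = m then u m * coldet n v else 0)"
    by (intro sum.cong refl) (simp add: inv)
  also have "\<dots> = coldet n v * u i"
    using assms by (simp add: mult.commute)
  finally show ?thesis by simp
qed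

text \<open>Cramer's rule expands \<open>W a b * d\<close> in the columns of \<open>W a b\<close>.
  Put into the last slot of \<open>W c d\<close>, the common columns give repeated columns, so only
  the terms of \<open>a\<close> and \<open>b\<close> survive.\<close>

lemma coldet_pluecker:
  fixes v :: "nat \<Rightarrow> nat \<Rightarrow> 'a::comm_ring_1"
  assumes "j \<noteq> k" "j < n" "k < n"
  defines "W \<equiv> \<lambda>x y. coldet n (v(j := x, k := y))"
  shows "W a b * W c d = W a d * W c b + W c a * W d b"
proof -
  let ?v = "v(j := a, k := b)"
  have "W a b * W c d = coldet n (v(j := c, k := \<lambda>i. W a b * d i))"
    using coldet_column_lincomb[OF assms(3), of "v(j := c)" "W a b" d 0 d]
    by (simp add: W_def)
  also have "\<dots> = coldet n (v(j := c, k := \<lambda>i. \<Sum>m<n. coldet n (?v(m := d)) * ?v m i))"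
    by (rule coldet_cong)
      (use coldet_column_cramer[of _ n ?v d] in \<open>auto simp: W_def mult.commute\<close>)
  also have "\<dots> = (\<Sum>m<n. coldet n (?v(m := d)) * coldet n (v(j := c, k := ?v m)))"
    by (rule coldet_column_sum[OF assms(3)])
  also have "\<dots> = (\<Sum>m\<in>{j, k}. coldet n (?v(m := d)) * coldet n (v(j := c, k := ?v m)))"
  proof (rule sum.mono_neutral_right)
    show "\<forall>m\<in>{..<n} - {j, k}. coldet n (?v(m := d)) * coldet n (v(j := c, k := ?v m)) = 0"
    proof
      fix m assume m: "m \<in> {..<n} - {j, k}"
      have "coldet n (v(j := c, k := ?v m)) = 0"
        by (rule coldet_identical_columns[of m k]) (use m assms in auto)
      then show "coldet n (?v(m := d)) * coldet n (v(j := c, k := ?v m)) = 0" by simp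
    qed
  qed (use assms in auto)
  also have "\<dots> = W d b * W c a + W a d * W c b"
    using assms by (simp add: fun_upd_twist)
  finally show ?thesis by (simp add: algebra_simps)
qed

section \<open>Column operations, row scaling and moving a column\<close>

text \<open>Right multiplication by a unit upper bidiagonal matrix. The added multiples are of the
  columns of \<open>v\<close>, not of the new columns \<open>w\<close>.\<close>

lemma coldet_upper_bidiagonal:
  assumes "\<And>i. i < n \<Longrightarrow> w 0 i = v 0 i"
    and "\<And>i j. i < n \<Longrightarrow> Suc j < n \<Longrightarrow> w (Suc j) i = v (Suc j) i + x j * v j i"
  shows "coldet n w = coldet n v"
proof -
  define m where "m = (\<lambda>k j. if k = j then 1 else if Suc k = j then x k else 0)"
  have "coldet n w = coldet n (\<lambda>j i. \<Sum>k<n. v k i * m k j)"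
  proof (rule coldet_cong)
    fix i j assume i: "i < n" and j: "j < n"
    show "w j i = (\<Sum>k<n. v k i * m k j)"
    proof (cases j)
      case 0
      have "(\<Sum>k<n. v k i * m k j) = (\<Sum>k\<in>{0}. v k i * m k j)"
        by (rule sum.mono_neutral_right) (use 0 j in \<open>auto simp: m_def\<close>)
      with 0 i assms show ?thesis by (simp add: m_def)
    next
      case (Suc l)
      have "(\<Sum>k<n. v k i * m k j) = (\<Sum>k\<in>{l, Suc l}. v k i * m k j)"
        by (rule sum.mono_neutral_right) (use Suc j in \<open>auto simp: m_def\<close>)
      with Suc i j assms show ?thesis by (simp add: m_def mult.commute)
    qed
  qed
  also have "\<dots> = coldet n v * det (mat n n (\<lambda>(k, j). m k j))"
    by (rule coldet_mult)
  also have "det (mat n n (\<lambda>(k, j). m k j)) = 1"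
    by (subst det_upper_triangular[of _ n])
      (auto simp: upper_triangular_def m_def prod_list_diag_prod)
  finally show ?thesis by simp
qed

lemma coldet_lower_bidiagonal:
  assumes "\<And>i. i < Suc n \<Longrightarrow> w n i = v n i"
    and "\<And>i j. i < Suc n \<Longrightarrow> j < n \<Longrightarrow> w j i = v j i + x j * v (Suc j) i"
  shows "coldet (Suc n) w = coldet (Suc n) v"
proof -
  define m where "m = (\<lambda>k j. if k = j then 1 else if k = Suc j then x j else 0)"
  have "coldet (Suc n) w = coldet (Suc n) (\<lambda>j i. \<Sum>k<Suc n. v k i * m k j)"
  proof (rule coldet_cong)
    fix i j assume i: "i < Suc n" and j: "j < Suc n"
    show "w j i = (\<Sum>k<Suc n. v k i * m k j)"
    proof (cases "j = n")
      case True
      have "(\<Sum>k<Suc n. v k i * m k j) = (\<Sum>k\<in>{n}. v k i * m k j)"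
        by (rule sum.mono_neutral_right) (use True in \<open>auto simp: m_def\<close>)
      with True i assms show ?thesis by (simp add: m_def)
    next
      case False
      have "(\<Sum>k<Suc n. v k i * m k j) = (\<Sum>k\<in>{j, Suc j}. v k i * m k j)"
        by (rule sum.mono_neutral_right) (use False j in \<open>auto simp: m_def\<close>)
      with False i j assms show ?thesis by (simp add: m_def mult.commute)
    qed
  qed
  also have "\<dots> = coldet (Suc n) v * det (mat (Suc n) (Suc n) (\<lambda>(k, j). m k j))"
    by (rule coldet_mult)
  also have "det (mat (Suc n) (Suc n) (\<lambda>(k, j). m k j)) = 1"
    by (subst det_lower_triangular[of "Suc n"])
      (auto simp: m_def prod_list_diag_prod)
  finally show ?thesis by simp
qed

lemma coldet_scale_rows:
  "coldet n (\<lambda>j i. c i * v j i) = (\<Prod>i<n. c i) * coldet n v"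
proof -
  let ?D = "mat n n (\<lambda>(i, k). if i = k then c i else 0)"
  have "mat n n (\<lambda>(i, j). c i * v j i) = ?D * mat n n (\<lambda>(i, j). v j i)"
  proof (rule eq_matI, goal_cases)
    case (1 i j)
    have "(\<Sum>k = 0..<n. (if i = k then c i else 0) * v j k) = (\<Sum>k\<in>{i}. c i * v j k)"
      by (rule sum.mono_neutral_cong_right) (use 1 in auto)
    with 1 show ?case by (simp add: scalar_prod_def)
  qed auto
  moreover have "det ?D = (\<Prod>i<n. c i)"
    by (subst det_upper_triangular[of _ n])
      (auto simp: upper_triangular_def prod_list_diag_prod lessThan_atLeast0)
  ultimately show ?thesis
    unfolding coldet_def by (simp add: det_mult[of _ n])
qed

lemma coldet_last_unit:
  "coldet (Suc n) (v(n := \<lambda>i. if i = n then 1 else 0)) = coldet n v"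
proof -
  let ?A = "mat (Suc n) (Suc n) (\<lambda>(i, j). v j i)"
  have "mat_delete ?A n n = mat n n (\<lambda>(i, j). v j i)"
    unfolding mat_delete_def by (rule eq_matI) auto
  moreover have "(\<Sum>i<n. (if i = n then 1 else 0) * cofactor ?A i n) = 0"
    by (rule sum.neutral) auto
  ultimately show ?thesis
    unfolding coldet_expand_column[OF lessI]
    by (simp add: cofactor_def coldet_def flip: mult_2)
qed

text \<open>Expansion along \<open>d\<close> meets the same minors on both sides, with signs
  \<open>(- 1) ^ i\<close> and \<open>(- 1) ^ (i + n)\<close>.\<close>

lemma coldet_rotate:
  fixes d :: "nat \<Rightarrow> 'a::comm_ring_1"
  shows "coldet (Suc n) (\<lambda>j. if j = 0 then d else v (j - 1)) = (- 1) ^ n * coldet (Suc n) (v(n := d))"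
proof -
  define w where "w = (\<lambda>j. if j = 0 then d else v (j - 1))"
  let ?A = "mat (Suc n) (Suc n) (\<lambda>(i, j). v j i)"
  let ?B = "mat (Suc n) (Suc n) (\<lambda>(i, j). w j i)"
  have "mat_delete ?B i 0 = mat_delete ?A i n" for i
    unfolding mat_delete_def w_def by (rule eq_matI) auto
  moreover have "(- 1) ^ n * (- 1) ^ (i + n) = (- 1 :: 'a) ^ i" for i
    by (simp add: power_add mult.left_commute flip: power_mult_distrib)
  ultimately have "cofactor ?B i 0 = (- 1) ^ n * cofactor ?A i n" for i
    by (simp add: cofactor_def flip: mult.assoc)
  moreover have "w = w(0 := d)" by (auto simp: w_def)
  ultimately have "coldet (Suc n) w = (- 1) ^ n * coldet (Suc n) (v(n := d))"
    using coldet_expand_column[of 0 "Suc n" w d] coldet_expand_column[of n "Suc n" v d]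
    by (simp add: sum_distrib_left algebra_simps del: sum.lessThan_Suc)
  then show ?thesis by (simp add: w_def)
qed


section \<open>Bilinear identities for column sequences with a three-term recurrence\<close>

text \<open>In each Pluecker bracket the recurrence turns scaled columns into shifted ones. The
  column \<open>d\<close> stays arbitrary, for two different choices later.\<close>

lemma coldet_shift_identity:
  fixes h :: "nat \<Rightarrow> nat \<Rightarrow> 'a::comm_ring_1"
  assumes rec: "\<And>i j. c i * h j i = h (j + 2) i + b * h (j + 1) i"
  shows "(\<Prod>i<Suc n. c i) * coldet (Suc n) h * coldet (Suc n) ((\<lambda>j. h (j + 2))(n := d))
    = b * coldet (Suc n) (\<lambda>j. h (j + 1)) * coldet (Suc n) ((\<lambda>j i. c i * h (j + 1) i)(n := d))
      + coldet (Suc n) (\<lambda>j. h (j + 2)) * coldet (Suc n) ((\<lambda>j i. c i * h j i)(n := d))"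
\<comment> \<open>The Pluecker relation needs the slots \<open>0\<close> and \<open>n\<close> to be
  different.\<close>
proof (cases "n = 0")
  case True
  have "c 0 * h 0 0 * d 0 = (h 2 0 + b * h 1 0) * d 0"
    using rec[of 0 0] by (simp add: numeral_2_eq_2)
  with True show ?thesis by (simp add: algebra_simps numeral_2_eq_2)
next
  case False
  define v where "v = (\<lambda>j i. c i * h j i)"
  define W where "W = (\<lambda>x y. coldet (Suc n) (v(0 := x, n := y)))"
  have ab: "W (v 0) (v n) = (\<Prod>i<Suc n. c i) * coldet (Suc n) h"
    unfolding W_def fun_upd_triv unfolding v_def by (rule coldet_scale_rows)
  have cd: "W (h 2) d = coldet (Suc n) ((\<lambda>j. h (j + 2))(n := d))"
    unfolding W_def
    \<comment> \<open>The coefficient is 0 in the last step because the last column is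
      \<open>d\<close>, which must stay unchanged.\<close>
    by (rule coldet_upper_bidiagonal[where x = "\<lambda>j. if Suc j = n then 0 else b"])
      (use False in \<open>auto simp: v_def rec numeral_2_eq_2\<close>)
  have ad: "W (v 0) d = coldet (Suc n) (v(n := d))"
    by (simp add: W_def)
  have cb: "W (h 2) (v n) = coldet (Suc n) (\<lambda>j. h (j + 2))"
    unfolding W_def
    by (rule coldet_upper_bidiagonal[where x = "\<lambda>_. b"])
      (use False in \<open>auto simp: v_def rec numeral_2_eq_2\<close>)
  \<comment> \<open>With \<open>h 1\<close> moved to the front, each \<open>v j\<close> stands after
    a column that absorbs its \<open>b\<close>-term.\<close>
  have "W (v 0) (h 1) = (- 1) ^ n * coldet (Suc n) (\<lambda>j. if j = 0 then h 1 else v (j - 1))"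
    by (simp add: W_def coldet_rotate flip: mult.assoc power_mult_distrib)
  also have "coldet (Suc n) (\<lambda>j. if j = 0 then h 1 else v (j - 1)) = coldet (Suc n) (\<lambda>j. h (j + 1))"
    by (rule coldet_upper_bidiagonal[where x = "\<lambda>_. b"]) (auto simp: v_def rec)
  finally have ah: "W (v 0) (h 1) = (- 1) ^ n * coldet (Suc n) (\<lambda>j. h (j + 1))" .
  \<comment> \<open>Solving the recurrence for \<open>h 2\<close> reduces this bracket to the
    previous one; this produces the factor \<open>b\<close>.\<close>
  have "h 2 = (\<lambda>i. 1 * v 0 i + (- b) * h 1 i)"
    using rec[of _ 0] by (auto simp: v_def numeral_2_eq_2)
  then have "W (v 0) (h 2) = W (v 0) (v 0) - b * W (v 0) (h 1)"
    unfolding W_def using coldet_column_lincomb[of n "Suc n" "v(0 := v 0)" 1 "v 0" "- b" "h 1"]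
    by simp
  moreover have "W (v 0) (v 0) = 0"
    unfolding W_def by (rule coldet_identical_columns[of 0 n]) (use False in auto)
  moreover have "W (h 2) (v 0) = - W (v 0) (h 2)"
    unfolding W_def by (rule coldet_swap) (use False in auto)
  ultimately have ca: "W (h 2) (v 0) = b * ((- 1) ^ n * coldet (Suc n) (\<lambda>j. h (j + 1)))"
    using ah by simp
  have "W d (v n) = coldet (Suc n) (\<lambda>j. if j = 0 then d else (\<lambda>j. v (j + 1)) (j - 1))"
    unfolding W_def using False by (intro coldet_cong) auto
  also have "\<dots> = (- 1) ^ n * coldet (Suc n) ((\<lambda>j. v (j + 1))(n := d))"
    by (rule coldet_rotate)
  finally have db: "W d (v n) = (- 1) ^ n * coldet (Suc n) ((\<lambda>j. v (j + 1))(n := d))" .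
  have "W (v 0) (v n) * W (h 2) d = W (v 0) d * W (h 2) (v n) + W (h 2) (v 0) * W d (v n)"
    unfolding W_def by (rule coldet_pluecker) (use False in auto)
  moreover have "W (h 2) (v 0) * W d (v n) = ((- 1) ^ n * (- 1) ^ n)
      * (b * coldet (Suc n) (\<lambda>j. h (j + 1)) * coldet (Suc n) ((\<lambda>j. v (j + 1))(n := d)))"
    by (simp only: ca db ac_simps)
  moreover have "(- 1) ^ n * (- 1) ^ n = (1 :: 'a)"
    by (simp flip: power_mult_distrib)
  ultimately show ?thesis
    unfolding ab cd ad cb by (simp add: v_def algebra_simps)
qed

text \<open>With the last unit vector as \<open>d\<close>, the determinants containing
  \<open>d\<close> shrink to size \<open>n\<close>. The scaled ones on the right yield only
  \<open>?C\<close>, so \<open>c n\<close> remains on the left after cancelling.\<close>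

lemma coldet_bilinear_size:
  fixes f :: "nat \<Rightarrow> nat \<Rightarrow> 'a::idom"
  assumes rec: "\<And>i j. c i * f j i = f (j + 2) i + b * f (j + 1) i"
    and nz: "\<And>i. c i \<noteq> 0"
  shows "c n * coldet n (\<lambda>j. f (j + 2)) * coldet (Suc n) f - coldet n f * coldet (Suc n) (\<lambda>j. f (j + 2))
    = b * coldet n (\<lambda>j. f (j + 1)) * coldet (Suc n) (\<lambda>j. f (j + 1))"
proof -
  let ?C = "\<Prod>i<n. c i"
  note coldet_shift_identity[of c f, OF rec, of n "\<lambda>i. if i = n then 1 else 0"]
  then have "?C * (c n * coldet n (\<lambda>j. f (j + 2)) * coldet (Suc n) f)
      = ?C * (coldet n f * coldet (Suc n) (\<lambda>j. f (j + 2))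
        + b * coldet n (\<lambda>j. f (j + 1)) * coldet (Suc n) (\<lambda>j. f (j + 1)))"
    unfolding coldet_last_unit coldet_scale_rows by (simp add: algebra_simps)
  moreover have "?C \<noteq> 0" using nz by simp
  ultimately show ?thesis by (simp only: mult_cancel_left) simp
qed

text \<open>The shift identity for \<open>g\<close>, which inherits the recurrence of
  \<open>f\<close>, with the scaled last column of \<open>f\<close> as \<open>d\<close>.\<close>

lemma coldet_bilinear_darboux:
  fixes f :: "nat \<Rightarrow> nat \<Rightarrow> 'a::idom"
  assumes rec: "\<And>i j. c i * f j i = f (j + 2) i + b * f (j + 1) i"
    and nz: "\<And>i. c i \<noteq> 0"
    and g: "\<And>i j. g j i = f j i - t * f (j + 1) i"
  shows "(1 + t * b) * coldet n (\<lambda>j. f (j + 2)) * coldet n g - coldet n f * coldet n (\<lambda>j. g (j + 2))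
    = t * b * coldet n (\<lambda>j. f (j + 1)) * coldet n (\<lambda>j. g (j + 1))"
proof -
  \<comment> \<open>The general argument uses the last two columns \<open>m\<close> and
    \<open>k\<close>, so sizes 0 and 1 are treated directly.\<close>
  consider "n = 0" | "n = 1" | m where "n = Suc (Suc m)"
    by (metis One_nat_def not0_implies_Suc)
  then show ?thesis
  proof cases
    case 1
    then show ?thesis by (simp add: coldet_def)
  next
    case 2
    \<comment> \<open>Two instances of the recurrence, from which \<open>c 0\<close> is eliminated
      by cross multiplication.\<close>
    have "f 2 0 + b * f 1 0 = c 0 * f 0 0" "f 3 0 + b * f 2 0 = c 0 * f 1 0"
      using rec[of 0 0] rec[of 0 1] by (simp_all add: eval_nat_numeral)
    then have "f 0 0 * (f 3 0 + b * f 2 0) - f 1 0 * (f 2 0 + b * f 1 0) = 0"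
      by (simp only:) simp
    moreover have "(1 + t * b) * f 2 0 * (f 0 0 - t * f 1 0) - f 0 0 * (f 2 0 - t * f 3 0)
        - t * b * f 1 0 * (f 1 0 - t * f 2 0)
      = t * (f 0 0 * (f 3 0 + b * f 2 0) - f 1 0 * (f 2 0 + b * f 1 0))"
      by (simp add: algebra_simps)
    ultimately show ?thesis
      using 2 by (simp add: g eval_nat_numeral)
  next
    case 3
    define C where "C = (\<Prod>i<n. c i)"
    have rec_g: "c i * g j i = g (j + 2) i + b * g (j + 1) i" for i j
    proof -
      have "c i * g j i = c i * f j i - t * (c i * f (j + 1) i)"
        by (simp add: g algebra_simps)
      also have "\<dots> = g (j + 2) i + b * g (j + 1) i"
        unfolding rec by (simp add: g algebra_simps)
      finally show ?thesis .
    qed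
    define k where "k = Suc m"
    define d where "d = (\<lambda>i. c i * f k i)"
    have n: "n = Suc k" using 3 by (simp add: k_def)
    \<comment> \<open>Since \<open>d\<close> is a scaled column too, the whole product
      \<open>C\<close> factors out.\<close>
    have "(\<lambda>j i. c i * g j i)(k := d) = (\<lambda>j i. c i * (g(k := f k)) j i)"
      by (auto simp: d_def)
    then have "coldet n ((\<lambda>j i. c i * g j i)(k := d)) = C * coldet n (g(k := f k))"
      by (simp only: coldet_scale_rows C_def)
    also have "coldet n (g(k := f k)) = coldet n f"
      unfolding n by (rule coldet_lower_bidiagonal[where x = "\<lambda>_. - t"]) (auto simp: g)
    finally have e3: "coldet n ((\<lambda>j i. c i * g j i)(k := d)) = C * coldet n f" .
    let ?V = "\<lambda>j. g (j + 1)"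
    have "(\<lambda>j i. c i * g (j + 1) i)(k := d) = (\<lambda>j i. c i * (?V(k := f k)) j i)"
      by (auto simp: d_def)
    then have "coldet n ((\<lambda>j i. c i * g (j + 1) i)(k := d)) = C * coldet n (?V(k := f k))"
      by (simp only: coldet_scale_rows C_def)
    \<comment> \<open>Column \<open>m\<close> is \<open>g k\<close>. Its part \<open>f k\<close>
      repeats column \<open>k\<close>; the other part, after a swap, leaves the factor
      \<open>t\<close>.\<close>
    also have "?V(k := f k) = ?V(k := f k, m := \<lambda>i. 1 * f k i + (- t) * f (k + 1) i)"
      by (auto simp: fun_eq_iff k_def g)
    also have "coldet n \<dots> = coldet n (?V(k := f k, m := f k)) - t * coldet n (?V(k := f k, m := f (k + 1)))"
      using coldet_column_lincomb[of m n "?V(k := f k)" 1 "f k" "- t" "f (k + 1)"]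
      by (simp add: 3)
    also have "coldet n (?V(k := f k, m := f k)) = 0"
      by (rule coldet_identical_columns[of k m]) (auto simp: n k_def)
    also have "coldet n (?V(k := f k, m := f (k + 1))) = - coldet n (?V(k := f (k + 1), m := f k))"
      by (rule coldet_swap) (auto simp: n k_def)
    also have "coldet n (?V(k := f (k + 1), m := f k)) = coldet n (\<lambda>j. f (j + 1))"
      unfolding n
      by (rule coldet_lower_bidiagonal[where x = "\<lambda>j. if j = m then 0 else - t"])
        (auto simp: g k_def)
    finally have e2: "coldet n ((\<lambda>j i. c i * g (j + 1) i)(k := d)) = t * C * coldet n (\<lambda>j. f (j + 1))"
      by (simp add: algebra_simps fun_upd_def)
    let ?U = "\<lambda>j. g (j + 2)"
    \<comment> \<open>Writing \<open>f (k + 1)\<close> as \<open>g (k + 1)\<close> plus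
      \<open>t\<close> times \<open>f (k + 2)\<close> gives the factor \<open>1 + t * b\<close>;
      column \<open>g (k + 1)\<close> already stands in slot \<open>m\<close> of
      \<open>?U\<close>.\<close>
    have "d = (\<lambda>i. (1 + t * b) * f (k + 2) i + b * g (k + 1) i)"
      unfolding d_def rec by (auto simp: g algebra_simps)
    then have "coldet n (?U(k := d)) = (1 + t * b) * coldet n (?U(k := f (k + 2))) + b * coldet n (?U(k := g (k + 1)))"
      by (simp only: coldet_column_lincomb n lessI)
    also have "coldet n (?U(k := g (k + 1))) = 0"
      by (rule coldet_identical_columns[of k m]) (auto simp: n k_def)
    also have "coldet n (?U(k := f (k + 2))) = coldet n (\<lambda>j. f (j + 2))"
      unfolding n by (rule coldet_lower_bidiagonal[where x = "\<lambda>_. - t"]) (auto simp: g)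
    finally have e1: "coldet n (?U(k := d)) = (1 + t * b) * coldet n (\<lambda>j. f (j + 2))"
      by (simp add: fun_upd_def)
    have "C * coldet n g * coldet n (?U(k := d))
        = b * coldet n ?V * coldet n ((\<lambda>j i. c i * g (j + 1) i)(k := d))
          + coldet n ?U * coldet n ((\<lambda>j i. c i * g j i)(k := d))"
      unfolding n C_def by (rule coldet_shift_identity[OF rec_g])
    then have "C * ((1 + t * b) * coldet n (\<lambda>j. f (j + 2)) * coldet n g)
        = C * (coldet n f * coldet n ?U + t * b * coldet n (\<lambda>j. f (j + 1)) * coldet n ?V)"
      unfolding e1 e2 e3 by (simp add: algebra_simps)
    moreover have "C \<noteq> 0" using nz by (simp add: C_def)
    ultimately show ?thesis by (simp only: mult_cancel_left) simp
  qed
qed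

section \<open>From the bilinear equations to the cross ratio\<close>

text \<open>The letters \<open>k\<close>, \<open>m\<close>, \<open>n\<close>, \<open>u\<close> stand
  for \<kappa> at the corners of a lattice square: base point, first, second, and both indices
  raised. The digit is the shift in \<open>s\<close>.\<close>

lemma cross_ratio_of_bilinear:
  fixes A B b t r :: "'a::field"
  assumes eqs: "A * k2 * m0 - k0 * m2 = b * k1 * m1" "A * n2 * u0 - n0 * u2 = b * n1 * u1"
      "B * k2 * n0 - k0 * n2 = t * b * k1 * n1" "B * m2 * u0 - m0 * u2 = t * b * m1 * u1"
    and nz: "A \<noteq> 0" "B \<noteq> 0" "k0 \<noteq> 0" "m0 \<noteq> 0" "n0 \<noteq> 0" "u0 \<noteq> 0"
    and z: "z = r * (k2 / k0)" "zm = inverse A * r * (m2 / m0)" "zn = inverse B * r * (n2 / n0)"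
      "zu = inverse A * inverse B * r * (u2 / u0)"
    and den: "(zm - zu) * (zn - z) \<noteq> 0"
  shows "((z - zm) * (zu - zn)) / ((zm - zu) * (zn - z)) = inverse A / (t\<^sup>2 / B)"
proof -
  have 1: "z - zm = r * (A * k2 * m0 - k0 * m2) / (A * k0 * m0)"
    and 2: "zu - zn = - (r * (A * n2 * u0 - n0 * u2) / (A * B * n0 * u0))"
    and 3: "zm - zu = r * (B * m2 * u0 - m0 * u2) / (A * B * m0 * u0)"
    and 4: "zn - z = - (r * (B * k2 * n0 - k0 * n2) / (B * k0 * n0))"
    using nz by (simp_all add: z field_simps)
  note diffs = 1 2 3 4
  \<comment> \<open>The two differences in the denominator already contain every factor that has to
    be cancelled.\<close>
  have "r \<noteq> 0" "b \<noteq> 0" "t \<noteq> 0" "k1 \<noteq> 0" "m1 \<noteq> 0" "n1 \<noteq> 0" "u1 \<noteq> 0"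
    using den unfolding diffs eqs by auto
  with nz show ?thesis
    unfolding diffs eqs by (simp add: field_simps power2_eq_square)
qed

section \<open>Specialisation to \<kappa>\<close>

lemma kappa_eq_coldet:
  "kappa \<phi> n l2 s = coldet n (\<lambda>j i. \<phi> (i + 1) l2 (s + int j))"
  unfolding kappa_def coldet_def ..

lemma phi_shift_s:
  assumes "q i = - p i - b" "p i \<noteq> 0" "q i \<noteq> 0"
  shows "- (p i * q i) * phi \<alpha> \<beta> p q P Q i l s
    = phi \<alpha> \<beta> p q P Q i l (s + 2) + b * phi \<alpha> \<beta> p q P Q i l (s + 1)"
proof -
  have sq: "p i ^ 2 + b * p i = - (p i * q i)" "q i ^ 2 + b * q i = - (p i * q i)"
    by (simp_all add: assms(1) power2_eq_square algebra_simps)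
  have "phi \<alpha> \<beta> p q P Q i l (s + 2) + b * phi \<alpha> \<beta> p q P Q i l (s + 1)
      = \<alpha> i * p i powi s * P i l * (p i ^ 2 + b * p i) + \<beta> i * q i powi s * Q i l * (q i ^ 2 + b * q i)"
    using assms(2,3) by (simp add: phi_def power_int_add algebra_simps)
  also have "\<dots> = - (p i * q i) * phi \<alpha> \<beta> p q P Q i l s"
    by (simp only: sq) (simp add: phi_def algebra_simps)
  finally show ?thesis ..
qed

text \<open>Raising \<open>l\<close> multiplies each exponential by \<open>1 - c2 l * p i\<close> or
  \<open>1 - c2 l * q i\<close>, and a factor \<open>p i\<close> or \<open>q i\<close> is a unit
  shift of \<open>s\<close>. The roots are nonzero, so this covers negative
  \<open>s\<close>.\<close>

lemma phi_shift_l2: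
  assumes "indefinite_product (\<lambda>j. 1 - c2 j * p i) (P i)"
    and "indefinite_product (\<lambda>j. 1 - c2 j * q i) (Q i)"
    and "p i \<noteq> 0" "q i \<noteq> 0"
  shows "phi \<alpha> \<beta> p q P Q i (l + 1) s
    = phi \<alpha> \<beta> p q P Q i l s - c2 l * phi \<alpha> \<beta> p q P Q i l (s + 1)"
proof -
  have PQ: "P i (l + 1) = (1 - c2 l * p i) * P i l" "Q i (l + 1) = (1 - c2 l * q i) * Q i l"
    using assms(1,2) by (simp_all add: indefinite_product_def)
  show ?thesis
    unfolding phi_def PQ using assms(3,4) by (simp add: power_int_add algebra_simps)
qed

theorem theorem2p7:
  fixes b :: complex
    and p q \<alpha> \<beta> :: "nat \<Rightarrow> complex"
    and c1 :: "nat \<Rightarrow> complex"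
    and c2 :: "int \<Rightarrow> complex"
    and P Q :: "nat \<Rightarrow> int \<Rightarrow> complex"
    and \<kappa> :: "nat \<Rightarrow> int \<Rightarrow> int \<Rightarrow> complex"
  assumes "\<And>i. i \<ge> 1 \<Longrightarrow> q i = - p i - b"
    and "\<And>i. i \<ge> 1 \<Longrightarrow> p i \<noteq> 0"
    and "\<And>i. i \<ge> 1 \<Longrightarrow> q i \<noteq> 0"
    and "\<And>i. i \<ge> 1 \<Longrightarrow> indefinite_product (\<lambda>j. 1 - c2 j * p i) (P i)"
    and "\<And>i. i \<ge> 1 \<Longrightarrow> indefinite_product (\<lambda>j. 1 - c2 j * q i) (Q i)"
    and "\<kappa> = kappa (phi \<alpha> \<beta> p q P Q)"
    and "c1 = (\<lambda>l1. (p (l1 + 1))^2 * (1 + b / p (l1 + 1)))"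
  shows
    "(\<forall>l1 l2 s.
        c1 l1 * \<kappa> l1 l2 (s + 2) * \<kappa> (l1 + 1) l2 s - \<kappa> l1 l2 s * \<kappa> (l1 + 1) l2 (s + 2)
          = b * \<kappa> l1 l2 (s + 1) * \<kappa> (l1 + 1) l2 (s + 1))
     \<and> (\<forall>l1 l2 s.
        (1 + c2 l2 * b) * \<kappa> l1 l2 (s + 2) * \<kappa> l1 (l2 + 1) s - \<kappa> l1 l2 s * \<kappa> l1 (l2 + 1) (s + 2)
          = c2 l2 * b * \<kappa> l1 l2 (s + 1) * \<kappa> l1 (l2 + 1) (s + 1))
     \<and> (\<forall>(s :: int) (R :: nat \<Rightarrow> complex) (S :: int \<Rightarrow> complex)
         (z :: nat \<Rightarrow> int \<Rightarrow> complex) (lam :: nat \<Rightarrow> complex) (mu :: int \<Rightarrow> complex).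
        (\<forall>j. 1 + c2 j * b \<noteq> 0)
        \<longrightarrow> indefinite_product (\<lambda>j. inverse (c1 j)) R
        \<longrightarrow> indefinite_product (\<lambda>j. inverse (1 + c2 j * b)) S
        \<longrightarrow> z = (\<lambda>l1 l2. R l1 * S l2 * (\<kappa> l1 l2 (s + 2) / \<kappa> l1 l2 s))
        \<longrightarrow> lam = (\<lambda>l1. inverse (c1 l1))
        \<longrightarrow> mu = (\<lambda>l2. (c2 l2)^2 / (1 + c2 l2 * b))
        \<longrightarrow> (\<forall>l1 l2.
              \<kappa> l1 l2 s \<noteq> 0 \<longrightarrow> \<kappa> (l1 + 1) l2 s \<noteq> 0
              \<longrightarrow> \<kappa> l1 (l2 + 1) s \<noteq> 0 \<longrightarrow> \<kappa> (l1 + 1) (l2 + 1) s \<noteq> 0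
              \<longrightarrow> (z (l1 + 1) l2 - z (l1 + 1) (l2 + 1)) * (z l1 (l2 + 1) - z l1 l2) \<noteq> 0
              \<longrightarrow> mu l2 \<noteq> 0
              \<longrightarrow> ((z l1 l2 - z (l1 + 1) l2) * (z (l1 + 1) (l2 + 1) - z l1 (l2 + 1)))
                    / ((z (l1 + 1) l2 - z (l1 + 1) (l2 + 1)) * (z l1 (l2 + 1) - z l1 l2))
                  = lam l1 / mu l2))"
proof -
  let ?\<phi> = "phi \<alpha> \<beta> p q P Q"
  define c where "c = (\<lambda>i. - (p (i + 1) * q (i + 1)))"
  \<comment> \<open>Here \<open>p * (p + b) = - p * q\<close>: the coefficient in the first equation
    is the diagonal entry of the added row, row \<open>i\<close> having index
    \<open>i + 1\<close>.\<close>
  have "p (i + 1) ^ 2 * (1 + b / p (i + 1)) = c i" for i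
    unfolding c_def using assms(2)[of "i + 1"]
    by (subst assms(1)) (simp_all add: field_simps power2_eq_square)
  then have c1: "c1 = c"
    by (simp add: assms(7))
  have c_nz: "c i \<noteq> 0" for i
    using assms(2,3) by (simp add: c_def)
  define f where "f = (\<lambda>l2 s j i. ?\<phi> (i + 1) l2 (s + int j))"
  have \<kappa>: "\<kappa> n l2 s = coldet n (f l2 s)" for n l2 s
    by (simp add: assms(6) kappa_eq_coldet f_def)
  have \<kappa>_shift: "\<kappa> n l2 (s + int k) = coldet n (\<lambda>j. f l2 s (j + k))" for n l2 s k
    by (simp add: assms(6) kappa_eq_coldet f_def add_ac)
  have rec: "c i * f l2 s j i = f l2 s (j + 2) i + b * f l2 s (j + 1) i" for l2 s i j
    using phi_shift_s[of q "i + 1" p b \<alpha> \<beta> P Q l2 "s + int j"] assms(1-3)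
    by (simp add: f_def c_def add_ac)
  have f_l2: "f (l2 + 1) s j i = f l2 s j i - c2 l2 * f l2 s (j + 1) i" for l2 s i j
    using phi_shift_l2[of c2 p "i + 1" P q Q \<alpha> \<beta> l2 "s + int j"] assms(2-5)
    by (simp add: f_def add_ac)
  have bil1: "c1 l1 * \<kappa> l1 l2 (s + 2) * \<kappa> (l1 + 1) l2 s - \<kappa> l1 l2 s * \<kappa> (l1 + 1) l2 (s + 2)
      = b * \<kappa> l1 l2 (s + 1) * \<kappa> (l1 + 1) l2 (s + 1)" for l1 l2 s
    using coldet_bilinear_size[of c "f l2 s", OF rec c_nz, of l1]
      \<kappa>_shift[of _ l2 s 1] \<kappa>_shift[of _ l2 s 2] by (simp add: c1 \<kappa>)
  have bil2: "(1 + c2 l2 * b) * \<kappa> l1 l2 (s + 2) * \<kappa> l1 (l2 + 1) s - \<kappa> l1 l2 s * \<kappa> l1 (l2 + 1) (s + 2)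
      = c2 l2 * b * \<kappa> l1 l2 (s + 1) * \<kappa> l1 (l2 + 1) (s + 1)" for l1 l2 s
    using coldet_bilinear_darboux[of c "f l2 s", OF rec c_nz f_l2, of l1]
      \<kappa>_shift[of _ _ s 1] \<kappa>_shift[of _ _ s 2] by (simp add: \<kappa>)
  show ?thesis
  proof (intro conjI allI impI, goal_cases)
    case 1
    show ?case by (rule bil1)
  next
    case 2
    show ?case by (rule bil2)
  next
    case (3 s R S z lam mu l1 l2)
    have R: "R (l1 + 1) = inverse (c1 l1) * R l1"
      and S: "S (l2 + 1) = inverse (1 + c2 l2 * b) * S l2"
      using 3(2,3) by (auto simp: indefinite_product_def)
    show ?case
      unfolding \<open>lam = _\<close> \<open>mu = _\<close>
      \<comment> \<open>One bilinear equation for each edge of the square. The arbitrary lower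
        limits of the products enter only through \<open>r\<close>, which cancels.\<close>
      by (rule cross_ratio_of_bilinear[OF bil1[of l1 l2 s] bil1[of l1 "l2 + 1" s]
            bil2[of l2 l1 s] bil2[of l2 "l1 + 1" s], where r = "R l1 * S l2"])
        (use 3 R S c_nz in \<open>simp_all add: c1\<close>)
  qed
qed

end
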